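(* Suppose that there exists an almost normal finite subgroup $H$ of $G$ such that $H\cap R(G)=\{1_G\}$. Let $(Y,G)$ be a dynamical system such that $Y_H\neq\emptyset$. Then there exist a dynamical system $(X,G)$, a factor map $\pi:X\to Y$, and a constant $m\geq 1$ such that $$\pi^{-1}(Y_H)\subseteq\{x\in X: G_x=\{1_G\}\}\quad\text{and}\quad |\pi^{-1}\{y\}|\leq m \text{ for all } y\in Y_H.$$ Moreover, (1) if $(Y,G)$ is minimal, then $(X,G)$ is minimal and topologically free; (2) if there exists an ergodic measure $\mu$ of $(Y,G)$ such that $\mu(Y_H)=1$, then $(X,G)$ is essentially free with respect to a lift of $\mu$.
   Context: A dynamical system $(X,G)$ is a countable discrete finitely generated group $G$ acting by homeomorphisms on a compact Hausdorff space $X$. It is minimal if $X$ is the only non-empty closed $G$-invariant subset of $X$. An invariant measure is a $G$-invariant Borel probability measure; it is ergodic if invariant Borel sets have measure $0$ or $1$. $G_x=\{g\in G: gx=x\}$. $(X,G)$ is topologically free if the set of points with trivial stabilizer is residual; $(X,G)$ is essentially free with respect to an invariant measure $\lambda$ if $\lambda$-a.e. point has trivial stabilizer. A factor map $\pi:X\to Y$ is a continuous surjective $G$-equivariant map. A lift of an invariant measure $\mu$ of $(Y,G)$ is an invariant measure $\lambda$ of $(X,G)$ with $\pi_*\lambda=\mu$. A subgroup $H$ of $G$ is almost normal if its normalizer $N_G(H)$ has finite index in $G$. $Y_H=\{y\in Y: G_y\text{ is conjugate to }H\text{ in }G\}$. $R(G)$ is the intersection of all finite index normal subgroups of $G$.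 *)

theory Defs
  imports
    "HOL-Probability.Probability"
    "HOL-Algebra.Group_Action"
    "HOL-Algebra.Generated_Groups"
begin

section \<open>Groups\<close>

definition finitely_generated :: "('g, 'c) monoid_scheme \<Rightarrow> bool" where
  "finitely_generated G \<longleftrightarrow>
     (\<exists>S. finite S \<and> S \<subseteq> carrier G \<and> generate G S = carrier G)"

definition finite_index :: "('g, 'c) monoid_scheme \<Rightarrow> 'g set \<Rightarrow> bool" where
  "finite_index G K \<longleftrightarrow> subgroup K G \<and> finite (rcosets\<^bsub>G\<^esub> K)"

definition almost_normal :: "('g, 'c) monoid_scheme \<Rightarrow> 'g set \<Rightarrow> bool" where
  "almost_normal G H \<longleftrightarrow> subgroup H G \<and> finite_index G (normalizer G H)"

definition finite_residual :: "('g, 'c) monoid_scheme \<Rightarrow> 'g set" where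
  "finite_residual G = \<Inter>{N. N \<lhd> G \<and> finite_index G N}"

definition conjugate_in :: "('g, 'c) monoid_scheme \<Rightarrow> 'g set \<Rightarrow> 'g set \<Rightarrow> bool" where
  "conjugate_in G K H \<longleftrightarrow>
     (\<exists>g\<in>carrier G. K = g <#\<^bsub>G\<^esub> H #>\<^bsub>G\<^esub> inv\<^bsub>G\<^esub> g)"

section \<open>Dynamical systems\<close>

text \<open>
  The group is discrete, so it carries no topology. Since
  \<^locale>\<open>group_action\<close> maps into the group of extensional bijections,
  each \<open>\<phi> g\<close> is \<open>undefined\<close> outside \<open>topspace X\<close>.
\<close>

locale dynamical_system = group_action G "topspace X" \<phi>
  for G :: "('g, 'c) monoid_scheme" (structure)
    and X :: "'x topology" and \<phi> :: "'g \<Rightarrow> 'x \<Rightarrow> 'x" +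
  assumes countable_group: "countable (carrier G)"
    and fin_gen: "finitely_generated G"
    and compact: "compact_space X"
    and Hausdorff: "Hausdorff_space X"
    and homeo: "\<And>g. g \<in> carrier G \<Longrightarrow> homeomorphic_map X X (\<phi> g)"

definition invariant_set ::
    "('g, 'c) monoid_scheme \<Rightarrow> ('g \<Rightarrow> 'x \<Rightarrow> 'x) \<Rightarrow> 'x set \<Rightarrow> bool" where
  "invariant_set G \<phi> A \<longleftrightarrow> (\<forall>g\<in>carrier G. \<phi> g ` A = A)"

definition minimal_system ::
    "('g, 'c) monoid_scheme \<Rightarrow> 'x topology \<Rightarrow> ('g \<Rightarrow> 'x \<Rightarrow> 'x) \<Rightarrow> bool" where
  "minimal_system G X \<phi> \<longleftrightarrow>
     {C. C \<noteq> {} \<and> closedin X C \<and> invariant_set G \<phi> C} = {topspace X}"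

definition residual_in :: "'x topology \<Rightarrow> 'x set \<Rightarrow> bool" where
  "residual_in X S \<longleftrightarrow> S \<subseteq> topspace X \<and>
     (\<exists>\<U>. countable \<U> \<and> (\<forall>U\<in>\<U>. openin X U \<and> X closure_of U = topspace X) \<and>
          topspace X \<inter> \<Inter>\<U> \<subseteq> S)"

definition free_points ::
    "('g, 'c) monoid_scheme \<Rightarrow> 'x topology \<Rightarrow> ('g \<Rightarrow> 'x \<Rightarrow> 'x) \<Rightarrow> 'x set" where
  "free_points G X \<phi> = {x \<in> topspace X. stabilizer G \<phi> x = {\<one>\<^bsub>G\<^esub>}}"

definition topologically_free ::
    "('g, 'c) monoid_scheme \<Rightarrow> 'x topology \<Rightarrow> ('g \<Rightarrow> 'x \<Rightarrow> 'x) \<Rightarrow> bool" where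
  "topologically_free G X \<phi> \<longleftrightarrow> residual_in X (free_points G X \<phi>)"

definition conj_stabilizer_points ::
    "('g, 'c) monoid_scheme \<Rightarrow> 'x topology \<Rightarrow> ('g \<Rightarrow> 'x \<Rightarrow> 'x) \<Rightarrow> 'g set \<Rightarrow> 'x set" where
  "conj_stabilizer_points G X \<phi> H =
     {x \<in> topspace X. conjugate_in G (stabilizer G \<phi> x) H}"

section \<open>Invariant measures\<close>

definition borel_algebra :: "'x topology \<Rightarrow> 'x measure" where
  "borel_algebra X = sigma (topspace X) {U. openin X U}"

text \<open>
  No regularity is required of a Borel measure. \<open>\<phi> g\<close> is Borel
  measurable for a dynamical system, so \<^const>\<open>distr\<close> is the genuine push-forward.
\<close>

definition invariant_measure ::
    "('g, 'c) monoid_scheme \<Rightarrow> 'x topology \<Rightarrow> ('g \<Rightarrow> 'x \<Rightarrow> 'x) \<Rightarrow> 'x measure \<Rightarrow> bool" where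
  "invariant_measure G X \<phi> \<mu> \<longleftrightarrow>
     prob_space \<mu> \<and> space \<mu> = topspace X \<and> sets \<mu> = sets (borel_algebra X) \<and>
     (\<forall>g\<in>carrier G. distr \<mu> \<mu> (\<phi> g) = \<mu>)"

definition ergodic_measure ::
    "('g, 'c) monoid_scheme \<Rightarrow> 'x topology \<Rightarrow> ('g \<Rightarrow> 'x \<Rightarrow> 'x) \<Rightarrow> 'x measure \<Rightarrow> bool" where
  "ergodic_measure G X \<phi> \<mu> \<longleftrightarrow> invariant_measure G X \<phi> \<mu> \<and>
     (\<forall>A\<in>sets \<mu>. invariant_set G \<phi> A \<longrightarrow> measure \<mu> A = 0 \<or> measure \<mu> A = 1)"

definition essentially_free ::
    "('g, 'c) monoid_scheme \<Rightarrow> ('g \<Rightarrow> 'x \<Rightarrow> 'x) \<Rightarrow> 'x measure \<Rightarrow> bool" where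
  "essentially_free G \<phi> \<mu> \<longleftrightarrow> (AE x in \<mu>. stabilizer G \<phi> x = {\<one>\<^bsub>G\<^esub>})"

section \<open>Factors and lifts\<close>

definition factor_map ::
    "('g, 'c) monoid_scheme \<Rightarrow> 'x topology \<Rightarrow> ('g \<Rightarrow> 'x \<Rightarrow> 'x) \<Rightarrow>
     'y topology \<Rightarrow> ('g \<Rightarrow> 'y \<Rightarrow> 'y) \<Rightarrow> ('x \<Rightarrow> 'y) \<Rightarrow> bool" where
  "factor_map G X \<phi> Y \<psi> \<pi> \<longleftrightarrow>
     continuous_map X Y \<pi> \<and> \<pi> ` topspace X = topspace Y \<and>
     (\<forall>g\<in>carrier G. \<forall>x\<in>topspace X. \<pi> (\<phi> g x) = \<psi> g (\<pi> x))"

definition lift_of ::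
    "('g, 'c) monoid_scheme \<Rightarrow> 'x topology \<Rightarrow> ('g \<Rightarrow> 'x \<Rightarrow> 'x) \<Rightarrow> ('x \<Rightarrow> 'y) \<Rightarrow>
     'y measure \<Rightarrow> 'x measure \<Rightarrow> bool" where
  "lift_of G X \<phi> \<pi> \<mu> \<nu> \<longleftrightarrow> invariant_measure G X \<phi> \<nu> \<and> distr \<nu> \<mu> \<pi> = \<mu>"

definition fiber :: "'x topology \<Rightarrow> ('x \<Rightarrow> 'y) \<Rightarrow> 'y \<Rightarrow> 'x set" where
  "fiber X \<pi> y = {x \<in> topspace X. \<pi> x = y}"

end

theory Submission
  imports Defs
begin

text \<open>
  A finite subgroup \<open>H\<close> that meets the finite residual trivially is already avoided
  by one normal subgroup \<open>N\<close> of finite index: each of the finitely many non-trivial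
  elements of \<open>H\<close> is missed by some such subgroup, and a finite intersection of
  these still has finite index. Let \<open>F = G / N\<close> and let \<open>G\<close> act on
  \<open>Y \<times> F\<close> diagonally. The stabilizer of \<open>(y, a)\<close> is
  \<open>G\<^sub>y \<inter> N\<close>. If \<open>G\<^sub>y\<close> is conjugate to \<open>H\<close>, this
  is a conjugate of \<open>H \<inter> N = {1}\<close>, so all points above \<open>Y\<^sub>H\<close> are
  free, and fibers have at most \<open>|F|\<close> points.

  When \<open>Y\<close> is not minimal, \<open>X = Y \<times> F\<close> serves. When \<open>Y\<close> is minimal,
  let \<open>X\<close> be a minimal subset of \<open>Y \<times> F\<close>; it projects onto \<open>Y\<close>.
  Topological freeness then follows from the existence of a single free point
  (\<open>minimal_imp_topologically_free\<close>): by minimality the orbit of that point enters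
  every non-empty open set, so no non-trivial group element fixes a non-empty open set
  pointwise.

  In both cases all fibers of \<open>X\<close> over \<open>Y\<close> have the same size \<open>k\<close>. For a
  minimal \<open>X\<close> the reason is that right translation by an element of \<open>F\<close>
  commutes with the action, so it maps \<open>X\<close> either into itself or off itself; the
  translations preserving \<open>X\<close> form a set that parametrizes every fiber
  (\<open>minimal_slice_card\<close>). Hence the uniform distribution on the fibers turns any
  invariant measure \<open>\<mu>\<close> of \<open>Y\<close> into an invariant measure of \<open>X\<close>
  lying above \<open>\<mu>\<close> (\<open>exists_lift\<close>), and it gives full measure to the free set
  above \<open>Y\<^sub>H\<close> as soon as \<open>\<mu>\<close> gives full measure to \<open>Y\<^sub>H\<close>.
\<close>

section \<open>Dynamical systems\<close>

text \<open>
  Bijectivity of each \<open>f g\<close> comes from its inverse \<open>f (inv g)\<close>, and continuity of the inverse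
  from compactness and the Hausdorff property, so continuity and the two action laws suffice.
\<close>
lemma dynamical_systemI:
  fixes G :: "('g, 'c) monoid_scheme" (structure)
  assumes grp: "group G" and "countable (carrier G)" and "finitely_generated G"
    and comp: "compact_space X" and haus: "Hausdorff_space X"
    and cont: "\<And>g. g \<in> carrier G \<Longrightarrow> continuous_map X X (f g)"
    and one: "\<And>x. x \<in> topspace X \<Longrightarrow> f \<one> x = x"
    and mult: "\<And>g h x. \<lbrakk>g \<in> carrier G; h \<in> carrier G; x \<in> topspace X\<rbrakk> \<Longrightarrow> f (g \<otimes> h) x = f g (f h x)"
  shows "dynamical_system G X (\<lambda>g. restrict (f g) (topspace X))"
proof -
  interpret group G by (rule grp)
  have clos: "f g x \<in> topspace X" if "g \<in> carrier G" "x \<in> topspace X" for g x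
    using cont[OF that(1)] that(2) by (auto simp: continuous_map_def)
  have bij: "bij_betw (f g) (topspace X) (topspace X)" if g: "g \<in> carrier G" for g
  proof (rule bij_betw_byWitness[where f' = "f (inv g)"])
    show "\<forall>x\<in>topspace X. f (inv g) (f g x) = x"
      using g mult[of "inv g" g] one by simp
    show "\<forall>x\<in>topspace X. f g (f (inv g) x) = x"
      using g mult[of g "inv g"] one by simp
  qed (use g clos in auto)
  have Bij: "restrict (f g) (topspace X) \<in> Bij (topspace X)" if "g \<in> carrier G" for g
    using bij[OF that] by (auto simp: Bij_def bij_betw_def inj_on_def)
  have "group_action G (topspace X) (\<lambda>g. restrict (f g) (topspace X))"
  proof (intro group_action.intro group_hom.intro group_hom_axioms.intro grp group_BijGroup)
    show "(\<lambda>g. restrict (f g) (topspace X)) \<in> hom G (BijGroup (topspace X))"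
      using Bij clos by (auto simp: hom_def BijGroup_def compose_def mult fun_eq_iff)
  qed
  moreover have "homeomorphic_map X X (restrict (f g) (topspace X))" if g: "g \<in> carrier G" for g
  proof -
    have "homeomorphic_map X X (f g)"
      using bij[OF g] by (intro continuous_imp_homeomorphic_map comp haus cont g) (auto simp: bij_betw_def)
    then show ?thesis by (rule homeomorphic_map_eq) simp
  qed
  ultimately show ?thesis
    using assms by (simp add: dynamical_system_def dynamical_system_axioms_def)
qed

context dynamical_system
begin

sublocale group G
  using group_hom by (rule group_hom.axioms)

lemma continuous: "g \<in> carrier G \<Longrightarrow> continuous_map X X (\<phi> g)"
  using homeo homeomorphic_imp_continuous_map by blast

lemma action_one: "x \<in> topspace X \<Longrightarrow> \<phi> \<one> x = x"
  using id_eq_one by (metis restrict_apply')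

lemma action_closed: "\<lbrakk>g \<in> carrier G; x \<in> topspace X\<rbrakk> \<Longrightarrow> \<phi> g x \<in> topspace X"
  using element_image by blast

lemma action_inv:
  assumes "g \<in> carrier G" "x \<in> topspace X"
  shows "\<phi> (inv g) (\<phi> g x) = x" "\<phi> g (\<phi> (inv g) x) = x"
  using assms composition_rule[of x "inv g" g] composition_rule[of x g "inv g"] action_one by auto

lemma invariant_setI:
  assumes "A \<subseteq> topspace X" and "\<And>g x. \<lbrakk>g \<in> carrier G; x \<in> A\<rbrakk> \<Longrightarrow> \<phi> g x \<in> A"
  shows "invariant_set G \<phi> A"
proof -
  have "A \<subseteq> \<phi> g ` A" if "g \<in> carrier G" for g
  proof
    fix x assume "x \<in> A"
    then have "x = \<phi> g (\<phi> (inv g) x)" and "\<phi> (inv g) x \<in> A"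
      using assms that by (auto simp: action_inv)
    then show "x \<in> \<phi> g ` A" by blast
  qed
  then show ?thesis using assms(2) by (auto simp: invariant_set_def)
qed

lemma dynamical_system_subtopology:
  assumes C: "closedin X C" and inv: "invariant_set G \<phi> C"
  shows "dynamical_system G (subtopology X C) (\<lambda>g. restrict (\<phi> g) C)"
proof -
  have CX: "C \<subseteq> topspace X" and top: "topspace (subtopology X C) = C"
    using closedin_subset[OF C] by auto
  have "dynamical_system G (subtopology X C) (\<lambda>g. restrict (\<phi> g) (topspace (subtopology X C)))"
  proof (rule dynamical_systemI)
    show "compact_space (subtopology X C)"
      using C compact closedin_compact_space compact_space_subtopology by blast
    show "continuous_map (subtopology X C) (subtopology X C) (\<phi> g)" if "g \<in> carrier G" for g
      using that continuous inv
      by (auto simp: continuous_map_in_subtopology continuous_map_from_subtopology invariant_set_def top)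
    show "Hausdorff_space (subtopology X C)" by (simp add: Hausdorff Hausdorff_space_subtopology)
  qed (use CX countable_group fin_gen action_one composition_rule in auto)
  then show ?thesis by (simp only: top)
qed

lemma minimal_system_subtopology:
  assumes C: "closedin X C" "C \<noteq> {}" "invariant_set G \<phi> C"
    and min: "\<And>D. \<lbrakk>D \<subseteq> C; D \<noteq> {}; closedin X D; invariant_set G \<phi> D\<rbrakk> \<Longrightarrow> D = C"
  shows "minimal_system G (subtopology X C) (\<lambda>g. restrict (\<phi> g) C)"
proof -
  have CX: "C \<subseteq> topspace X" and top: "topspace (subtopology X C) = C"
    using closedin_subset[OF C(1)] by auto
  have "invariant_set G (\<lambda>g. restrict (\<phi> g) C) D \<longleftrightarrow> invariant_set G \<phi> D" if "D \<subseteq> C" for D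
  proof -
    have "restrict (\<phi> g) C ` D = \<phi> g ` D" for g using that by (auto simp: image_def subset_iff)
    then show ?thesis by (simp add: invariant_set_def)
  qed
  then show ?thesis
    using C min unfolding minimal_system_def top closedin_closed_subtopology[OF C(1)] by blast
qed

lemma minimal_systemD:
  assumes "minimal_system G X \<phi>" "C \<noteq> {}" "closedin X C" "invariant_set G \<phi> C"
  shows "C = topspace X"
proof -
  have "C \<in> {C. C \<noteq> {} \<and> closedin X C \<and> invariant_set G \<phi> C}" using assms(2-) by simp
  then show ?thesis using assms(1) unfolding minimal_system_def by simp
qed

text \<open>
  Zorn's lemma is applied to complements: the union of a non-empty chain of proper open sets with
  invariant complement is again proper, since otherwise compactness would make a single member of
  the chain equal to the whole space.
\<close>
lemma exists_minimal_subsystem: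
  assumes "topspace X \<noteq> {}"
  obtains C where "closedin X C" "C \<noteq> {}" "invariant_set G \<phi> C"
    and "\<And>D. \<lbrakk>D \<subseteq> C; D \<noteq> {}; closedin X D; invariant_set G \<phi> D\<rbrakk> \<Longrightarrow> D = C"
proof -
  let ?\<A> = "{U. openin X U \<and> U \<noteq> topspace X \<and> invariant_set G \<phi> (topspace X - U)}"
  have "\<exists>M\<in>?\<A>. \<forall>U\<in>?\<A>. M \<subseteq> U \<longrightarrow> U = M"
  proof (rule subset_Zorn_nonempty)
    have "invariant_set G \<phi> (topspace X)" by (rule invariant_setI) (auto simp: action_closed)
    then have "{} \<in> ?\<A>" using assms by (auto simp del: subtopology_topspace null_topspace_iff_trivial)
    then show "?\<A> \<noteq> {}" by blast
    fix \<C> assume ne: "\<C> \<noteq> {}" and ch: "subset.chain ?\<A> \<C>"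
    then have sub: "\<C> \<subseteq> ?\<A>" by (auto simp: subset.chain_def)
    have "\<Union>\<C> \<noteq> topspace X"
    proof
      assume eq: "\<Union>\<C> = topspace X"
      have "\<exists>\<F>. finite \<F> \<and> \<F> \<subseteq> \<C> \<and> topspace X \<subseteq> \<Union>\<F>"
      proof -
        have "\<forall>U\<in>\<C>. openin X U" "topspace X \<subseteq> \<Union>\<C>" using sub eq by auto
        then show ?thesis using compact by (auto simp: compact_space_alt)
      qed
      then obtain \<F> where \<F>: "finite \<F>" "\<F> \<subseteq> \<C>" "topspace X \<subseteq> \<Union>\<F>" by blast
      then have "\<F> \<noteq> {}" using assms by auto
      then have "\<Union>\<F> \<in> \<F>"
      proof (rule Union_in_chain[OF \<F>(1)])
        have "subset.chain \<A> \<F>" if "subset.chain \<A> \<C>" for \<A>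
          using that \<F>(2) by (auto simp: subset_chain_def) (metis subset_iff)
        then show "subset.chain ?\<A> \<F>" using ch .
      qed
      then have "\<Union>\<F> \<in> ?\<A>" using sub \<F>(2) by blast
      then show False using \<F>(3) openin_subset by blast
    qed
    moreover have "openin X (\<Union>\<C>)" using sub by (intro openin_Union) auto
    moreover have "invariant_set G \<phi> (topspace X - \<Union>\<C>)"
    proof (rule invariant_setI)
      fix g x assume g: "g \<in> carrier G" and x: "x \<in> topspace X - \<Union>\<C>"
      have "\<phi> g x \<in> topspace X - U" if "U \<in> \<C>" for U
        using that sub g x by (fastforce simp: invariant_set_def)
      then show "\<phi> g x \<in> topspace X - \<Union>\<C>" using ne by blast
    qed auto
    ultimately show "\<Union>\<C> \<in> ?\<A>" by simp
  qed
  then obtain M where M: "M \<in> ?\<A>" and max: "\<And>U. U \<in> ?\<A> \<Longrightarrow> M \<subseteq> U \<Longrightarrow> U = M" by blast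
  show thesis
  proof
    show "closedin X (topspace X - M)" "topspace X - M \<noteq> {}" "invariant_set G \<phi> (topspace X - M)"
      using M openin_subset by auto
    fix D assume D: "D \<subseteq> topspace X - M" "D \<noteq> {}" "closedin X D" "invariant_set G \<phi> D"
    then have "topspace X - D = M"
      using M openin_subset closedin_subset[OF D(3)]
      by (intro max) (auto simp: double_diff)
    then show "D = topspace X - M" using closedin_subset[OF D(3)] by blast
  qed
qed

text \<open>
  The points whose orbit avoids \<open>U\<close> form a closed invariant set that misses \<open>U\<close>, so by
  minimality there are none.
\<close>
lemma minimal_orbit_meets_open:
  assumes min: "minimal_system G X \<phi>" and U: "openin X U" "U \<noteq> {}" and x: "x \<in> topspace X"
  obtains g where "g \<in> carrier G" "\<phi> g x \<in> U"
proof -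
  let ?C = "{x \<in> topspace X. \<forall>g\<in>carrier G. \<phi> g x \<notin> U}"
  have "?C = topspace X \<inter> (\<Inter>g\<in>carrier G. {x \<in> topspace X. \<phi> g x \<in> topspace X - U})"
    by (auto simp: action_closed)
  moreover have "closedin X {x \<in> topspace X. \<phi> g x \<in> topspace X - U}" if "g \<in> carrier G" for g
    using that U by (intro closedin_continuous_map_preimage[OF continuous]) auto
  ultimately have "closedin X ?C"
    using one_closed by (auto intro!: closedin_Int closedin_Inter)
  moreover have "invariant_set G \<phi> ?C"
    by (rule invariant_setI) (auto simp: action_closed composition_rule[symmetric])
  moreover have "?C \<noteq> topspace X"
  proof -
    obtain u where "u \<in> U" "u \<in> topspace X" using U openin_subset[OF U(1)] by blast
    then have "u \<notin> ?C" using action_one by (auto intro!: bexI[of _ \<one>])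
    then show ?thesis using \<open>u \<in> topspace X\<close> by blast
  qed
  ultimately have "?C = {}" using minimal_systemD[OF min, of ?C] by metis
  then show thesis using x that by blast
qed

text \<open>
  Suppose the fixed point set of \<open>h\<close> has an interior point. Some \<open>\<phi> g x\<close> with \<open>x\<close> free
  lies in that interior, so \<open>inv g \<otimes> h \<otimes> g\<close> fixes \<open>x\<close>, which forces \<open>h = \<one>\<close>.
  Thus the free points are the intersection of countably many dense open sets, the complements of
  the fixed point sets of the non-trivial elements.
\<close>
lemma minimal_imp_topologically_free:
  assumes min: "minimal_system G X \<phi>" and "free_points G X \<phi> \<noteq> {}"
  shows "topologically_free G X \<phi>"
proof -
  obtain x where x: "x \<in> topspace X" and free: "stabilizer G \<phi> x = {\<one>}"
    using assms(2) by (auto simp: free_points_def)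
  define Fix where "Fix h = {z \<in> topspace X. \<phi> h z = z}" for h
  let ?\<U> = "(\<lambda>h. topspace X - Fix h) ` (carrier G - {\<one>})"
  have clFix: "closedin X (Fix h)" if "h \<in> carrier G" for h
    unfolding Fix_def
    using closedin_continuous_maps_eq[OF Hausdorff continuous[OF that] continuous_map_id[unfolded id_def]] by simp
  have dense: "X closure_of (topspace X - Fix h) = topspace X" if h: "h \<in> carrier G" "h \<noteq> \<one>" for h
  proof -
    have "X interior_of Fix h = {}"
    proof (rule ccontr)
      assume ne: "X interior_of Fix h \<noteq> {}"
      obtain g where g: "g \<in> carrier G" "\<phi> g x \<in> X interior_of Fix h"
        by (rule minimal_orbit_meets_open[OF min openin_interior_of ne x])
      then have "\<phi> h (\<phi> g x) = \<phi> g x"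
        using interior_of_subset[of X "Fix h"] by (auto simp: Fix_def)
      then have "\<phi> (inv g \<otimes> h \<otimes> g) x = x"
        using g(1) h(1) x by (simp add: composition_rule action_closed action_inv)
      then have "inv g \<otimes> h \<otimes> g \<in> stabilizer G \<phi> x"
        using g(1) h(1) by (simp add: stabilizer_def)
      then have "inv g \<otimes> h \<otimes> g = \<one>" using free by simp
      then have "h = \<one>" using g(1) h(1) inv_equality[of "inv g \<otimes> h" g] l_cancel_one[of "inv g" h] by simp
      then show False using h(2) by simp
    qed
    then show ?thesis by (metis Diff_empty closure_of_complement)
  qed
  show ?thesis
    unfolding topologically_free_def residual_in_def
  proof (intro conjI exI[of _ ?\<U>])
    show "free_points G X \<phi> \<subseteq> topspace X" by (auto simp: free_points_def)
    show "countable ?\<U>" using countable_group by auto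
    show "\<forall>U\<in>?\<U>. openin X U \<and> X closure_of U = topspace X" using clFix dense by auto
    show "topspace X \<inter> \<Inter>?\<U> \<subseteq> free_points G X \<phi>"
      by (auto simp: free_points_def stabilizer_def Fix_def action_one)
  qed
qed

end

section \<open>Finite quotients separating a finite subgroup from the identity\<close>

text \<open>
  A coset of \<open>K \<inter> L\<close> is the intersection of a coset of \<open>K\<close> with a coset of \<open>L\<close>,
  so there are only finitely many of them.
\<close>
lemma (in group) finite_index_Int:
  assumes "finite_index G K" "finite_index G L"
  shows "finite_index G (K \<inter> L)"
proof -
  have KL: "K \<subseteq> carrier G" "L \<subseteq> carrier G"
    using assms subgroup.subset by (auto simp: finite_index_def)
  have coset: "(K \<inter> L) #> a = (K #> a) \<inter> (L #> a)" if a: "a \<in> carrier G" for a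
  proof
    show "(K #> a) \<inter> (L #> a) \<subseteq> (K \<inter> L) #> a"
    proof
      fix x assume "x \<in> (K #> a) \<inter> (L #> a)"
      then obtain k l where "k \<in> K" "l \<in> L" and x: "x = k \<otimes> a" "x = l \<otimes> a"
        by (auto simp: r_coset_def)
      moreover from this have "k = l" using KL a right_cancel by (metis subsetD)
      ultimately show "x \<in> (K \<inter> L) #> a" by (auto simp: r_coset_def)
    qed
  qed (auto simp: r_coset_def)
  have "rcosets (K \<inter> L) \<subseteq> (\<lambda>(A, B). A \<inter> B) ` ((rcosets K) \<times> (rcosets L))"
  proof
    fix A assume "A \<in> rcosets (K \<inter> L)"
    then obtain a where "a \<in> carrier G" "A = (K \<inter> L) #> a" by (auto simp: RCOSETS_def)
    then have "A = (\<lambda>(A, B). A \<inter> B) (K #> a, L #> a)"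
      and "(K #> a, L #> a) \<in> (rcosets K) \<times> (rcosets L)"
      using coset by (auto simp: RCOSETS_def)
    then show "A \<in> (\<lambda>(A, B). A \<inter> B) ` ((rcosets K) \<times> (rcosets L))" by (rule image_eqI)
  qed
  then have "finite (rcosets (K \<inter> L))"
    by (rule finite_subset) (use assms in \<open>auto simp: finite_index_def\<close>)
  then show ?thesis
    using assms by (simp add: finite_index_def subgroups_Inter_pair)
qed

lemma (in group) finite_index_carrier: "finite_index G (carrier G)"
proof -
  have "rcosets (carrier G) \<subseteq> {carrier G}"
    by (auto simp: RCOSETS_def coset_join2 subgroup_self)
  then show ?thesis using subgroup_self finite_subset by (auto simp: finite_index_def)
qed

text \<open>
  Each element outside the finite residual is missed by some normal subgroup of finite index;
  the finitely many subgroups obtained in this way are intersected.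
\<close>
lemma (in group) exists_normal_finite_index_avoiding:
  assumes "finite S" "S \<inter> finite_residual G = {}"
  shows "\<exists>N. N \<lhd> G \<and> finite_index G N \<and> S \<inter> N = {}"
  using assms
proof (induction S rule: finite_induct)
  case empty
  have "carrier G \<lhd> G" by (simp add: normal_inv_iff subgroup_self)
  then show ?case using finite_index_carrier by blast
next
  case (insert s S)
  then obtain N where N: "N \<lhd> G" "finite_index G N" "S \<inter> N = {}" by auto
  obtain M where M: "M \<lhd> G" "finite_index G M" "s \<notin> M"
    using insert.prems by (auto simp: finite_residual_def)
  have "M \<inter> N \<lhd> G" using M N by (simp add: normal_subgroup_intersect)
  moreover have "finite_index G (M \<inter> N)" using M N finite_index_Int by blast
  ultimately show ?case using M N by blast
qed

text \<open>
  Conjugating back, an element of \<open>K \<inter> N\<close> becomes one of \<open>H \<inter> N\<close>, since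
  \<open>N\<close> is normal.
\<close>
lemma (in group) conjugate_Int_normal_trivial:
  assumes N: "N \<lhd> G" and H: "subgroup H G" and K: "conjugate_in G K H" and HN: "H \<inter> N \<subseteq> {\<one>}"
  shows "K \<inter> N = {\<one>}"
proof -
  interpret N: normal N G by (rule N)
  obtain g where g: "g \<in> carrier G" and K: "K = g <# H #> inv g"
    using K by (auto simp: conjugate_in_def)
  have K': "K = {g \<otimes> h \<otimes> inv g | h. h \<in> H}"
    unfolding K by (auto simp: l_coset_def r_coset_def)
  have "g \<otimes> h \<otimes> inv g = \<one>" if h: "h \<in> H" "g \<otimes> h \<otimes> inv g \<in> N" for h
  proof -
    have hc: "h \<in> carrier G" using h H subgroup.mem_carrier by fastforce
    have "inv g \<otimes> (g \<otimes> h \<otimes> inv g) \<otimes> g \<in> N"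
      using N.inv_op_closed1[OF g h(2)] .
    also have "inv g \<otimes> (g \<otimes> h \<otimes> inv g) \<otimes> g = h"
      using g hc by (simp add: m_assoc) (simp flip: m_assoc)
    finally have "h = \<one>" using h(1) HN by blast
    then show ?thesis using g by simp
  qed
  moreover have "\<one> \<in> K"
    using subgroup.one_closed[OF H] g unfolding K' by force
  ultimately show ?thesis using N.one_closed unfolding K' by blast
qed

section \<open>Skew products with a finite group\<close>

text \<open>
  \<open>F\<close> stands for the quotient of \<open>G\<close> by a normal subgroup of finite index and \<open>q\<close> for the
  quotient map; an abstract finite group keeps cosets out of the computations.
\<close>
locale finite_skew_product = dynamical_system G Y \<psi> + group_hom G F q
  for G :: "('g, 'c) monoid_scheme" (structure)
    and Y :: "'y topology" and \<psi> :: "'g \<Rightarrow> 'y \<Rightarrow> 'y"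
    and F :: "('f, 'd) monoid_scheme" and q :: "'g \<Rightarrow> 'f" +
  assumes finite_fiber_group: "finite (carrier F)"
begin

definition skew_space :: "('y \<times> 'f) topology" where
  "skew_space = prod_topology Y (discrete_topology (carrier F))"

definition skew_action :: "'g \<Rightarrow> 'y \<times> 'f \<Rightarrow> 'y \<times> 'f" where
  "skew_action g = (\<lambda>(y, a)\<in>topspace Y \<times> carrier F. (\<psi> g y, q g \<otimes>\<^bsub>F\<^esub> a))"

lemma topspace_skew_space [simp]: "topspace skew_space = topspace Y \<times> carrier F"
  by (simp add: skew_space_def)

lemma skew_action_apply:
  "\<lbrakk>y \<in> topspace Y; a \<in> carrier F\<rbrakk> \<Longrightarrow> skew_action g (y, a) = (\<psi> g y, q g \<otimes>\<^bsub>F\<^esub> a)"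
  by (simp add: skew_action_def)

lemma q_closed: "g \<in> carrier G \<Longrightarrow> q g \<in> carrier F"
  by (rule hom_closed)

lemma continuous_map_fst_skew: "continuous_map skew_space Y fst"
  by (simp add: skew_space_def continuous_map_fst)

lemma continuous_map_skew_prod:
  assumes f: "continuous_map Y Y f" and h: "h \<in> carrier F \<rightarrow> carrier F"
  shows "continuous_map skew_space skew_space (\<lambda>(y, a). (f y, h a))"
proof -
  have "continuous_map (discrete_topology (carrier F)) (discrete_topology (carrier F)) h"
    using h by (auto simp: continuous_map_from_discrete_topology)
  then show ?thesis
    unfolding skew_space_def case_prod_unfold using f
    by (intro continuous_map_pairedI continuous_map_compose[OF continuous_map_fst, unfolded o_def]
          continuous_map_compose[OF continuous_map_snd, unfolded o_def])
qed

lemma dynamical_system_skew: "dynamical_system G skew_space skew_action"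
proof -
  have "dynamical_system G skew_space
    (\<lambda>g. restrict (\<lambda>(y, a). (\<psi> g y, q g \<otimes>\<^bsub>F\<^esub> a)) (topspace skew_space))"
  proof (rule dynamical_systemI)
    show "compact_space skew_space" "Hausdorff_space skew_space"
      using compact Hausdorff finite_fiber_group
      by (simp_all add: skew_space_def compact_space_prod_topology Hausdorff_space_prod_topology
          compact_space_discrete_topology)
    show "continuous_map skew_space skew_space (\<lambda>(y, a). (\<psi> g y, q g \<otimes>\<^bsub>F\<^esub> a))"
      if "g \<in> carrier G" for g
      using that continuous q_closed by (intro continuous_map_skew_prod) auto
  qed (use countable_group fin_gen group_axioms action_one composition_rule q_closed in
        \<open>auto simp: hom_mult H.m_assoc\<close>)
  then show ?thesis by (simp add: skew_action_def[abs_def] case_prod_unfold restrict_def)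
qed

sublocale skew: dynamical_system G skew_space skew_action
  by (rule dynamical_system_skew)

lemma stabilizer_skew:
  assumes "y \<in> topspace Y" "a \<in> carrier F"
  shows "stabilizer G skew_action (y, a) = stabilizer G \<psi> y \<inter> kernel G F q"
  using assms by (auto simp: stabilizer_def kernel_def skew_action_apply)

abbreviation slice :: "('y \<times> 'f) set \<Rightarrow> 'y \<Rightarrow> 'f set" where
  "slice C y \<equiv> {a. (y, a) \<in> C}"

text \<open>
  Let \<open>K\<close> be the set of \<open>b\<close> whose right translation maps \<open>C\<close> into itself. The points of
  \<open>C\<close> that the translation by \<open>b\<close> keeps in \<open>C\<close> form a closed invariant subset, because
  left and right multiplication commute; by minimality \<open>b \<in> K\<close> as soon as this subset is
  non-empty. Every \<open>y\<close> has some \<open>(y, a) \<in> C\<close> above it, and then \<open>b \<mapsto> ab\<close> is a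
  bijection from \<open>K\<close> onto the fiber over \<open>y\<close>; the size of \<open>K\<close> does not depend on
  \<open>y\<close>.
\<close>
lemma minimal_slice_card:
  assumes C: "closedin skew_space C" "invariant_set G skew_action C"
    and min: "\<And>D. \<lbrakk>D \<subseteq> C; D \<noteq> {}; closedin skew_space D; invariant_set G skew_action D\<rbrakk> \<Longrightarrow> D = C"
    and surj: "fst ` C = topspace Y"
  shows "\<exists>k. \<forall>y\<in>topspace Y. card (slice C y) = k"
proof -
  have CX: "C \<subseteq> topspace Y \<times> carrier F" using closedin_subset[OF C(1)] by simp
  define K where "K = {b \<in> carrier F. \<forall>(y, a)\<in>C. (y, a \<otimes>\<^bsub>F\<^esub> b) \<in> C}"
  have K: "b \<in> K" if b: "b \<in> carrier F" and p: "(y, a) \<in> C" "(y, a \<otimes>\<^bsub>F\<^esub> b) \<in> C" for y a b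
  proof -
    let ?\<rho> = "\<lambda>(y, a). (id y, a \<otimes>\<^bsub>F\<^esub> b)"
    let ?D = "C \<inter> {p \<in> topspace skew_space. ?\<rho> p \<in> C}"
    have "continuous_map skew_space skew_space ?\<rho>"
      using b by (intro continuous_map_skew_prod) auto
    then have "closedin skew_space ?D"
      using C(1) by (intro closedin_Int closedin_continuous_map_preimage)
    moreover have "invariant_set G skew_action ?D"
    proof (rule skew.invariant_setI)
      fix g p assume g: "g \<in> carrier G" and p: "p \<in> ?D"
      obtain z c where zc: "p = (z, c)" "z \<in> topspace Y" "c \<in> carrier F"
        using p by auto
      have "skew_action g (z, c) \<in> C" "skew_action g (z, c \<otimes>\<^bsub>F\<^esub> b) \<in> C"
        using C(2) g p zc unfolding invariant_set_def by auto
      then show "skew_action g p \<in> ?D"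
        using zc b g q_closed by (auto simp: skew_action_apply H.m_assoc action_closed)
    qed auto
    moreover have "(y, a) \<in> ?D" using p CX by auto
    ultimately have "?D = C" using min[of ?D] by blast
    then show ?thesis using b by (fastforce simp: K_def)
  qed
  have "card (slice C y) = card K" if y: "y \<in> topspace Y" for y
  proof -
    obtain a where a: "(y, a) \<in> C" using y surj by force
    then have aF: "a \<in> carrier F" using CX by auto
    have "bij_betw (\<lambda>b. a \<otimes>\<^bsub>F\<^esub> b) K (slice C y)"
    proof (rule bij_betw_byWitness[where f' = "\<lambda>c. inv\<^bsub>F\<^esub> a \<otimes>\<^bsub>F\<^esub> c"])
      show "\<forall>b\<in>K. inv\<^bsub>F\<^esub> a \<otimes>\<^bsub>F\<^esub> (a \<otimes>\<^bsub>F\<^esub> b) = b"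
        using aF by (simp add: K_def flip: H.m_assoc)
      show "\<forall>c\<in>slice C y. a \<otimes>\<^bsub>F\<^esub> (inv\<^bsub>F\<^esub> a \<otimes>\<^bsub>F\<^esub> c) = c"
        using aF CX by (auto simp flip: H.m_assoc)
      show "(\<lambda>b. a \<otimes>\<^bsub>F\<^esub> b) ` K \<subseteq> slice C y" using a by (auto simp: K_def)
      show "(\<lambda>c. inv\<^bsub>F\<^esub> a \<otimes>\<^bsub>F\<^esub> c) ` slice C y \<subseteq> K"
      proof clarify
        fix c assume c: "(y, c) \<in> C"
        then have "c \<in> carrier F" using CX by auto
        then show "inv\<^bsub>F\<^esub> a \<otimes>\<^bsub>F\<^esub> c \<in> K"
          using aF a c by (intro K[of _ y a]) (auto simp flip: H.m_assoc)
      qed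
    qed
    then show ?thesis by (simp add: bij_betw_same_card)
  qed
  then show ?thesis by blast
qed

text \<open>
  The projection of \<open>C\<close> is compact, hence closed, and it is invariant by equivariance, so
  minimality of \<open>Y\<close> applies to it.
\<close>
lemma fst_image_minimal:
  assumes min: "minimal_system G Y \<psi>"
    and C: "closedin skew_space C" "C \<noteq> {}" "invariant_set G skew_action C"
  shows "fst ` C = topspace Y"
proof (rule minimal_systemD[OF min])
  have CX: "C \<subseteq> topspace Y \<times> carrier F" using closedin_subset[OF C(1)] by simp
  show "fst ` C \<noteq> {}" using C by simp
  have "compactin skew_space C" using C skew.compact closedin_compact_space by blast
  then have "compactin Y (fst ` C)" by (rule image_compactin[OF _ continuous_map_fst_skew])
  then show "closedin Y (fst ` C)" by (rule compactin_imp_closedin[OF Hausdorff])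
  show "invariant_set G \<psi> (fst ` C)"
  proof (rule invariant_setI)
    fix g y assume g: "g \<in> carrier G" and "y \<in> fst ` C"
    then obtain a where a: "(y, a) \<in> C" by force
    then have "skew_action g (y, a) \<in> C" using C(3) g by (auto simp: invariant_set_def)
    then show "\<psi> g y \<in> fst ` C" using a CX by (force simp: skew_action_apply)
  qed (use CX in auto)
qed

end

section \<open>Lifting invariant measures\<close>

lemma sets_borel_algebra: "sets (borel_algebra X) = sigma_sets (topspace X) {U. openin X U}"
  unfolding borel_algebra_def by (intro sets_measure_of) (auto dest: openin_subset)

lemma space_borel_algebra [simp]: "space (borel_algebra X) = topspace X"
  by (simp add: borel_algebra_def space_measure_of_conv)

lemma openin_imp_borel: "openin X U \<Longrightarrow> U \<in> sets (borel_algebra X)"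
  by (simp add: sets_borel_algebra sigma_sets.Basic)

lemma closedin_imp_borel:
  assumes "closedin X C" shows "C \<in> sets (borel_algebra X)"
proof -
  have "topspace X - C \<in> sets (borel_algebra X)"
    using assms by (intro openin_imp_borel) auto
  then have "topspace X - (topspace X - C) \<in> sets (borel_algebra X)"
    using sets.compl_sets[of _ "borel_algebra X"] by simp
  then show ?thesis using closedin_subset[OF assms] by (simp add: double_diff)
qed

lemma continuous_map_imp_borel_measurable:
  assumes "continuous_map X Y f"
  shows "f \<in> measurable (borel_algebra X) (borel_algebra Y)"
  unfolding borel_algebra_def[of Y]
proof (rule measurable_measure_of)
  show "f -` U \<inter> space (borel_algebra X) \<in> sets (borel_algebra X)" if "U \<in> {U. openin Y U}" for U
  proof -
    have "f -` U \<inter> space (borel_algebra X) = {x \<in> topspace X. f x \<in> U}" by auto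
    then show ?thesis
      using openin_continuous_map_preimage[OF assms] that by (simp add: openin_imp_borel)
  qed
qed (use assms in \<open>auto dest: openin_subset simp: continuous_map_def\<close>)

context finite_skew_product
begin

abbreviation section_at :: "'f \<Rightarrow> ('y \<times> 'f) set \<Rightarrow> 'y set" where
  "section_at a A \<equiv> {y \<in> topspace Y. (y, a) \<in> A}"

text \<open>
  For relatively open sets the section is an open set intersected with the closed section of
  \<open>C\<close>; the general case is by induction over the generated \<open>\<sigma>\<close>-algebra.
\<close>
lemma section_at_borel:
  assumes C: "closedin skew_space C" and a: "a \<in> carrier F"
    and A: "A \<in> sets (borel_algebra (subtopology skew_space C))"
  shows "section_at a A \<in> sets (borel_algebra Y)"
proof -
  have cont: "continuous_map Y skew_space (\<lambda>y. (y, a))"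
    using a by (simp add: skew_space_def continuous_map_pairwise o_def)
  have CX: "C \<subseteq> topspace skew_space" using closedin_subset[OF C] .
  have Ca: "section_at a C \<in> sets (borel_algebra Y)"
    using closedin_continuous_map_preimage[OF cont C] by (rule closedin_imp_borel)
  have "A \<in> sigma_sets C {U. openin (subtopology skew_space C) U}"
    using A CX by (simp add: sets_borel_algebra inf.absorb2)
  then show ?thesis
  proof (induction rule: sigma_sets.induct)
    case (Basic U)
    then obtain T where T: "openin skew_space T" "U = T \<inter> C"
      by (auto simp: openin_subtopology)
    have "section_at a U = section_at a T \<inter> section_at a C" using T by auto
    moreover have "section_at a T \<in> sets (borel_algebra Y)"
      using openin_continuous_map_preimage[OF cont T(1)] by (rule openin_imp_borel)
    ultimately show ?case using Ca by simp
  next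
    case (Compl A)
    have "section_at a (C - A) = section_at a C - section_at a A" by auto
    then show ?case using Ca Compl.IH by simp
  next
    case (Union A)
    have "section_at a (\<Union>i. A i) = (\<Union>i. section_at a (A i))" by auto
    then show ?case using Union.IH by auto
  qed auto
qed

text \<open>
  The lift is the average of \<open>\<mu>\<close> over the fibers, each carrying the uniform distribution:
  \<open>\<nu> A = (1 / k) \<cdot> (\<Sum>a. \<mu> {y. (y, a) \<in> A})\<close>. It lies above \<open>\<mu>\<close>
  because every fiber contributes \<open>k\<close> points, and it is invariant because an element \<open>g\<close>
  permutes the summands by \<open>a \<mapsto> q g \<otimes> a\<close> while \<open>\<mu>\<close> is invariant under \<open>\<psi> g\<close>.
\<close>
lemma exists_lift:
  assumes C: "closedin skew_space C" "invariant_set G skew_action C"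
    and card: "\<And>y. y \<in> topspace Y \<Longrightarrow> card (slice C y) = k" and k: "k > 0"
    and \<mu>: "invariant_measure G Y \<psi> \<mu>"
  shows "\<exists>\<nu>. lift_of G (subtopology skew_space C) (\<lambda>g. restrict (skew_action g) C) fst \<mu> \<nu>"
proof -
  let ?X = "subtopology skew_space C"
  let ?\<phi> = "\<lambda>g. restrict (skew_action g) C"
  have CX: "C \<subseteq> topspace Y \<times> carrier F" using closedin_subset[OF C(1)] by simp
  have topX: "topspace ?X = C" using CX by (simp add: inf.absorb2)
  interpret X: dynamical_system G ?X ?\<phi>
    using C by (rule skew.dynamical_system_subtopology)
  interpret \<mu>: prob_space \<mu> using \<mu> by (simp add: invariant_measure_def)
  have \<mu>_space: "space \<mu> = topspace Y" and \<mu>_sets: "sets \<mu> = sets (borel_algebra Y)"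
    and \<mu>_inv: "\<And>g. g \<in> carrier G \<Longrightarrow> distr \<mu> \<mu> (\<psi> g) = \<mu>"
    using \<mu> by (auto simp: invariant_measure_def)
  have sec: "section_at a A \<in> sets \<mu>"
    if "A \<in> sets (borel_algebra ?X)" "a \<in> carrier F" for a A
    using section_at_borel[OF C(1)] that \<mu>_sets by simp
  define c where "c = ennreal (1 / real k)"
  have "c * of_nat k = 1"
    using k by (simp add: c_def ennreal_of_nat_eq_real_of_nat flip: ennreal_mult)
  then have ck: "c * (of_nat k * x) = x" for x by (simp flip: mult.assoc)
  define m where "m A = c * (\<Sum>a\<in>carrier F. emeasure \<mu> (section_at a A))" for A
  define \<nu> where "\<nu> = measure_of C (sets (borel_algebra ?X)) m"
  have sig: "sigma_algebra C (sets (borel_algebra ?X))"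
    using sets.sigma_algebra_axioms[of "borel_algebra ?X"] topX by simp
  have \<nu>_space: "space \<nu> = C"
    by (simp add: \<nu>_def space_measure_of_conv)
  have \<nu>_sets: "sets \<nu> = sets (borel_algebra ?X)"
    unfolding \<nu>_def using sig by (simp add: sigma_algebra.sets_measure_of_eq)
  have \<nu>_eq: "emeasure \<nu> A = m A" if "A \<in> sets (borel_algebra ?X)" for A
    unfolding \<nu>_def
  proof (rule emeasure_measure_of_sigma[OF sig _ _ that])
    show "positive (sets (borel_algebra ?X)) m" by (simp add: positive_def m_def)
    show "countably_additive (sets (borel_algebra ?X)) m"
    proof (rule countably_additiveI)
      fix A :: "nat \<Rightarrow> _" assume A: "range A \<subseteq> sets (borel_algebra ?X)" "disjoint_family A"
      have "(\<Sum>i. emeasure \<mu> (section_at a (A i))) = emeasure \<mu> (section_at a (\<Union>i. A i))"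
        if a: "a \<in> carrier F" for a
      proof -
        have "section_at a (\<Union>i. A i) = (\<Union>i. section_at a (A i))" by auto
        moreover have "disjoint_family (\<lambda>i. section_at a (A i))"
          using A(2) by (auto simp: disjoint_family_on_def)
        ultimately show ?thesis
          using A(1) sec a by (subst suminf_emeasure) auto
      qed
      then show "(\<Sum>i. m (A i)) = m (\<Union>i. A i)"
        by (simp add: m_def suminf_sum)
    qed
  qed
  (* Fubini with the counting measure: for y in B exactly k of the sections contain y. *)
  have m_full: "m ((B \<times> carrier F) \<inter> C) = emeasure \<mu> B" if B: "B \<in> sets \<mu>" for B
  proof -
    have meas: "section_at a ((B \<times> carrier F) \<inter> C) \<in> sets \<mu>" if a: "a \<in> carrier F" for a
    proof -
      have "C \<in> sets (borel_algebra ?X)"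
        using sets.top[of "borel_algebra ?X"] topX by simp
      moreover have "section_at a ((B \<times> carrier F) \<inter> C) = B \<inter> section_at a C"
        using a sets.sets_into_space[OF B] \<mu>_space by auto
      ultimately show ?thesis using sec[OF _ a] B by simp
    qed
    have "(\<Sum>a\<in>carrier F. emeasure \<mu> (section_at a ((B \<times> carrier F) \<inter> C)))
       = (\<Sum>a\<in>carrier F. \<integral>\<^sup>+y. indicator (section_at a ((B \<times> carrier F) \<inter> C)) y \<partial>\<mu>)"
      using meas by simp
    also have "\<dots> = (\<integral>\<^sup>+y. (\<Sum>a\<in>carrier F. indicator (section_at a ((B \<times> carrier F) \<inter> C)) y) \<partial>\<mu>)"
      using meas by (subst nn_integral_sum) auto
    also have "\<dots> = (\<integral>\<^sup>+y. of_nat k * indicator B y \<partial>\<mu>)"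
    proof (rule nn_integral_cong)
      fix y assume "y \<in> space \<mu>"
      then have y: "y \<in> topspace Y" using \<mu>_space by simp
      have sl: "carrier F \<inter> slice C y = slice C y" using CX by auto
      have "(\<Sum>a\<in>carrier F. indicator (section_at a ((B \<times> carrier F) \<inter> C)) y)
          = (\<Sum>a\<in>carrier F. if a \<in> slice C y then indicator B y else (0 :: ennreal))"
        using y by (intro sum.cong) (auto simp: indicator_def)
      also have "\<dots> = of_nat k * indicator B y"
        using finite_fiber_group card[OF y] by (simp add: sum.If_cases sl)
      finally show "(\<Sum>a\<in>carrier F. indicator (section_at a ((B \<times> carrier F) \<inter> C)) y)
          = of_nat k * (indicator B y :: ennreal)" .
    qed
    also have "\<dots> = of_nat k * emeasure \<mu> B"
      using B by (simp add: nn_integral_cmult_indicator)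
    finally show ?thesis by (simp add: m_def ck)
  qed
  have fst_meas: "fst \<in> measurable \<nu> \<mu>"
  proof -
    have "fst \<in> measurable (borel_algebra ?X) (borel_algebra Y)"
      by (intro continuous_map_imp_borel_measurable continuous_map_from_subtopology continuous_map_fst_skew)
    then show ?thesis by (simp cong: measurable_cong_sets add: \<nu>_sets \<mu>_sets)
  qed
  have lift: "distr \<nu> \<mu> fst = \<mu>"
  proof (rule measure_eqI)
    fix B assume "B \<in> sets (distr \<nu> \<mu> fst)"
    then have B: "B \<in> sets \<mu>" by simp
    have "fst -` B \<inter> space \<nu> = (B \<times> carrier F) \<inter> C" using CX \<nu>_space by auto
    then show "emeasure (distr \<nu> \<mu> fst) B = emeasure \<mu> B"
      using measurable_sets[OF fst_meas B] fst_meas B m_full \<nu>_eq \<nu>_sets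
      by (simp add: emeasure_distr)
  qed simp
  have "prob_space (distr \<nu> \<mu> fst)" using \<mu>.prob_space_axioms lift by simp
  then have prob: "prob_space \<nu>" by (rule prob_space_distrD[OF fst_meas])
  have inv: "distr \<nu> \<nu> (?\<phi> g) = \<nu>" if g: "g \<in> carrier G" for g
  proof (rule measure_eqI)
    fix A assume "A \<in> sets (distr \<nu> \<nu> (?\<phi> g))"
    then have A: "A \<in> sets (borel_algebra ?X)" by (simp add: \<nu>_sets)
    have AC: "A \<subseteq> C" using sets.sets_into_space[OF A] topX by simp
    have meas: "?\<phi> g \<in> measurable \<nu> \<nu>"
      using continuous_map_imp_borel_measurable[OF X.continuous[OF g]]
      by (simp cong: measurable_cong_sets add: \<nu>_sets)
    let ?A = "?\<phi> g -` A \<inter> space \<nu>"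
    have A': "?A \<in> sets (borel_algebra ?X)"
      using measurable_sets[OF meas] A \<nu>_sets by simp
    have mem: "skew_action g p \<in> C \<longleftrightarrow> p \<in> C" if "p \<in> topspace skew_space" for p
    proof
      assume "skew_action g p \<in> C"
      then have "skew_action (inv g) (skew_action g p) \<in> C"
        using C(2) g unfolding invariant_set_def by blast
      then show "p \<in> C" using skew.action_inv(1)[OF g that] by simp
    qed (use C(2) g in \<open>auto simp: invariant_set_def\<close>)
    have \<psi>_meas: "\<psi> g \<in> measurable \<mu> \<mu>"
      using continuous_map_imp_borel_measurable[OF continuous[OF g]]
      by (simp cong: measurable_cong_sets add: \<mu>_sets)
    (* the section of the preimage at a is the preimage under \<psi> g of the section at q g * a *)
    have eq: "emeasure \<mu> (section_at a ?A) = emeasure \<mu> (section_at (q g \<otimes>\<^bsub>F\<^esub> a) A)"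
      if a: "a \<in> carrier F" for a
    proof -
      have ga: "q g \<otimes>\<^bsub>F\<^esub> a \<in> carrier F" using a g q_closed by simp
      have "section_at a ?A = \<psi> g -` section_at (q g \<otimes>\<^bsub>F\<^esub> a) A \<inter> space \<mu>"
        using a g AC mem by (auto simp: \<nu>_space \<mu>_space skew_action_apply action_closed)
      also have "emeasure \<mu> \<dots> = emeasure (distr \<mu> \<mu> (\<psi> g)) (section_at (q g \<otimes>\<^bsub>F\<^esub> a) A)"
        using sec[OF A ga] \<psi>_meas by (simp add: emeasure_distr)
      finally show ?thesis using \<mu>_inv[OF g] by simp
    qed
    have "emeasure (distr \<nu> \<nu> (?\<phi> g)) A = m ?A"
      using A A' meas \<nu>_sets \<nu>_eq by (simp add: emeasure_distr)
    also have "\<dots> = c * (\<Sum>a\<in>carrier F. emeasure \<mu> (section_at (q g \<otimes>\<^bsub>F\<^esub> a) A))"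
      unfolding m_def using eq by simp
    also have "\<dots> = m A"
    proof -
      have "bij_betw (\<lambda>a. q g \<otimes>\<^bsub>F\<^esub> a) (carrier F) (carrier F)"
        using q_closed[OF g]
        by (intro bij_betw_byWitness[where f' = "\<lambda>a. inv\<^bsub>F\<^esub> (q g) \<otimes>\<^bsub>F\<^esub> a"])
           (auto simp flip: H.m_assoc)
      then show ?thesis unfolding m_def by (subst sum.reindex_bij_betw) auto
    qed
    finally show "emeasure (distr \<nu> \<nu> (?\<phi> g)) A = emeasure \<nu> A" using A \<nu>_eq by simp
  qed simp
  show ?thesis
    using prob \<nu>_space \<nu>_sets inv lift topX
    by (auto simp: lift_of_def invariant_measure_def intro!: exI[of _ \<nu>])
qed

end

section \<open>Free finite-to-one extensions\<close>

context finite_skew_product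
begin

text \<open>
  One subsystem serves the minimal and the measure-theoretic assertions at once: a minimal subset
  if \<open>Y\<close> is minimal, and the whole product otherwise.
\<close>
lemma exists_uniform_subsystem:
  assumes ne: "topspace Y \<noteq> {}"
  obtains C k where "closedin skew_space C" "invariant_set G skew_action C"
    and "fst ` C = topspace Y" "k > 0" "\<forall>y\<in>topspace Y. card (slice C y) = k"
    and "minimal_system G Y \<psi> \<longrightarrow>
           minimal_system G (subtopology skew_space C) (\<lambda>g. restrict (skew_action g) C)"
proof (cases "minimal_system G Y \<psi>")
  case True
  have "topspace skew_space \<noteq> {}" using ne H.one_closed by auto
  then obtain C where C: "closedin skew_space C" "C \<noteq> {}" "invariant_set G skew_action C"
    and min: "\<And>D. \<lbrakk>D \<subseteq> C; D \<noteq> {}; closedin skew_space D; invariant_set G skew_action D\<rbrakk> \<Longrightarrow> D = C"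
    using skew.exists_minimal_subsystem by metis
  have surj: "fst ` C = topspace Y" by (rule fst_image_minimal[OF True C])
  have "\<exists>k. \<forall>y\<in>topspace Y. card (slice C y) = k"
    by (rule minimal_slice_card[OF C(1,3) min surj])
  then obtain k where k: "\<forall>y\<in>topspace Y. card (slice C y) = k" ..
  obtain y a where ya: "(y, a) \<in> C" using C(2) by auto
  then have y: "y \<in> topspace Y" using closedin_subset[OF C(1)] by auto
  have "slice C y \<subseteq> carrier F" using closedin_subset[OF C(1)] by auto
  then have "finite (slice C y)" using finite_fiber_group finite_subset by blast
  then have k0: "k > 0" using bspec[OF k y] ya by (auto simp: card_gt_0_iff)
  have "minimal_system G (subtopology skew_space C) (\<lambda>g. restrict (skew_action g) C)"
    by (rule skew.minimal_system_subtopology[OF C min])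
  then show thesis by (intro that[OF C(1,3) surj k0 k] impI)
next
  case False
  let ?C = "topspace skew_space"
  have inv: "invariant_set G skew_action ?C"
    using skew.surj_prop by (simp add: invariant_set_def)
  have ne: "carrier F \<noteq> {}" using H.one_closed by blast
  then have surj: "fst ` ?C = topspace Y" by simp
  have pos: "card (carrier F) > 0" using finite_fiber_group ne by (simp add: card_gt_0_iff)
  have card: "\<forall>y\<in>topspace Y. card (slice ?C y) = card (carrier F)" by simp
  show thesis
    using False by (intro that[OF closedin_topspace inv surj pos card] impI) (rule notE)
qed

lemma factor_map_fst:
  assumes C: "closedin skew_space C" and surj: "fst ` C = topspace Y"
  shows "factor_map G (subtopology skew_space C) (\<lambda>g. restrict (skew_action g) C) Y \<psi> fst"
proof -
  have CX: "C \<subseteq> topspace skew_space" using closedin_subset[OF C] .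
  have "fst (skew_action g p) = \<psi> g (fst p)" if "p \<in> C" for g p
    using that CX by (auto simp: skew_action_def)
  then show ?thesis
    using CX surj by (auto simp: factor_map_def inf.absorb2
        intro!: continuous_map_from_subtopology[OF continuous_map_fst_skew])
qed

lemma fiber_fst:
  assumes "closedin skew_space C"
  shows "fiber (subtopology skew_space C) fst y = Pair y ` slice C y"
  using closedin_subset[OF assms] by (auto simp: fiber_def)

end

theorem proposition1p9:
  fixes G :: "('g, 'c) monoid_scheme"
    and H :: "'g set"
    and Y :: "'y topology"
    and \<psi> :: "'g \<Rightarrow> 'y \<Rightarrow> 'y"
  assumes "dynamical_system G Y \<psi>"
    and "subgroup H G" and "finite H" and "almost_normal G H"
    and "H \<inter> finite_residual G = {\<one>\<^bsub>G\<^esub>}"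
    and "conj_stabilizer_points G Y \<psi> H \<noteq> {}"
  shows "\<exists>(X :: ('y \<times> 'g set) topology) \<phi> \<pi> (m :: nat).
    dynamical_system G X \<phi> \<and> factor_map G X \<phi> Y \<psi> \<pi> \<and> m \<ge> 1 \<and>
    {x \<in> topspace X. \<pi> x \<in> conj_stabilizer_points G Y \<psi> H} \<subseteq> free_points G X \<phi> \<and>
    (\<forall>y \<in> conj_stabilizer_points G Y \<psi> H.
       finite (fiber X \<pi> y) \<and> card (fiber X \<pi> y) \<le> m) \<and>
    (minimal_system G Y \<psi> \<longrightarrow> minimal_system G X \<phi> \<and> topologically_free G X \<phi>) \<and>
    (\<forall>\<mu>. ergodic_measure G Y \<psi> \<mu> \<and>
          measure \<mu> (conj_stabilizer_points G Y \<psi> H) = 1 \<longrightarrow>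
       (\<exists>\<nu>. lift_of G X \<phi> \<pi> \<mu> \<nu> \<and> essentially_free G \<phi> \<nu>))"
proof -
  let ?Y\<^sub>H = "conj_stabilizer_points G Y \<psi> H"
  interpret Y: dynamical_system G Y \<psi> by fact
  have "finite (H - {\<one>\<^bsub>G\<^esub>})" "(H - {\<one>\<^bsub>G\<^esub>}) \<inter> finite_residual G = {}"
    using assms(3,5) by auto
  then obtain N where N: "N \<lhd> G" "finite_index G N" and "(H - {\<one>\<^bsub>G\<^esub>}) \<inter> N = {}"
    using Y.exists_normal_finite_index_avoiding[of "H - {\<one>\<^bsub>G\<^esub>}"] by auto
  then have HN: "H \<inter> N \<subseteq> {\<one>\<^bsub>G\<^esub>}" by blast
  interpret N: normal N G by (rule N(1))
  let ?F = "G Mod N" and ?q = "\<lambda>g. N #>\<^bsub>G\<^esub> g"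
  interpret finite_skew_product G Y \<psi> ?F ?q
  proof (intro finite_skew_product.intro finite_skew_product_axioms.intro group_hom.intro
      group_hom_axioms.intro)
    show "finite (carrier ?F)" using N(2) by (simp add: finite_index_def FactGroup_def)
  qed (use assms(1) Y.group_axioms N.factorgroup_is_group N.r_coset_hom_Mod in auto)
  have ker: "kernel G ?F ?q = N"
    using N.subset N.rcos_const[OF Y.group_axioms] Y.rcos_self[OF _ N.subgroup_axioms]
    by (auto simp: kernel_def)
  have ne: "topspace Y \<noteq> {}" using assms(6) unfolding conj_stabilizer_points_def by blast
  obtain C k where C: "closedin skew_space C" "invariant_set G skew_action C"
    and surj: "fst ` C = topspace Y" and k: "k > 0" "\<forall>y\<in>topspace Y. card (slice C y) = k"
    and min: "minimal_system G Y \<psi> \<longrightarrow>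
           minimal_system G (subtopology skew_space C) (\<lambda>g. restrict (skew_action g) C)"
    by (rule exists_uniform_subsystem[OF ne]) (rule that)
  let ?X = "subtopology skew_space C" and ?\<phi> = "\<lambda>g. restrict (skew_action g) C"
  have CX: "C \<subseteq> topspace Y \<times> carrier ?F" using closedin_subset[OF C(1)] by simp
  have topX: "topspace ?X = C" using CX by (simp add: inf.absorb2)
  interpret X: dynamical_system G ?X ?\<phi>
    using C by (rule skew.dynamical_system_subtopology)
  have stab: "stabilizer G ?\<phi> p = {\<one>\<^bsub>G\<^esub>}" if p: "p \<in> C" "fst p \<in> ?Y\<^sub>H" for p
  proof -
    obtain y a where ya: "p = (y, a)" "y \<in> topspace Y" "a \<in> carrier ?F" using p CX by auto
    have "stabilizer G ?\<phi> p = stabilizer G skew_action p"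
      using p by (simp add: stabilizer_def)
    also have "\<dots> = stabilizer G \<psi> y \<inter> N" using ya stabilizer_skew ker by simp
    also have "\<dots> = {\<one>\<^bsub>G\<^esub>}"
    proof (rule Y.conjugate_Int_normal_trivial[OF N(1) assms(2) _ HN])
      show "conjugate_in G (stabilizer G \<psi> y) H"
        using p(2) ya(1) unfolding conj_stabilizer_points_def by simp
    qed
    finally show ?thesis .
  qed
  have free: "{x \<in> topspace ?X. fst x \<in> ?Y\<^sub>H} \<subseteq> free_points G ?X ?\<phi>"
  proof
    fix p assume "p \<in> {x \<in> topspace ?X. fst x \<in> ?Y\<^sub>H}"
    then have "p \<in> C" "fst p \<in> ?Y\<^sub>H" unfolding topX by auto
    then show "p \<in> free_points G ?X ?\<phi>"
      using stab unfolding free_points_def topX by (intro CollectI conjI)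
  qed
  have fib: "finite (fiber ?X fst y) \<and> card (fiber ?X fst y) \<le> k" if "y \<in> ?Y\<^sub>H" for y
  proof -
    have "y \<in> topspace Y" using that by (simp add: conj_stabilizer_points_def)
    then have "card (slice C y) = k" by (rule bspec[OF k(2)])
    moreover from this have "finite (slice C y)" using k(1) by (intro card_ge_0_finite) simp
    ultimately show ?thesis
      unfolding fiber_fst[OF C(1)] by (simp add: card_image inj_on_def)
  qed
  have "topologically_free G ?X ?\<phi>" if "minimal_system G Y \<psi>"
  proof -
    obtain y where y: "y \<in> ?Y\<^sub>H" using assms(6) by blast
    then have "y \<in> fst ` C" using surj by (simp add: conj_stabilizer_points_def)
    then obtain p where "p \<in> C" "fst p = y" by blast
    then have "p \<in> {x \<in> topspace ?X. fst x \<in> ?Y\<^sub>H}" using y topX by simp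
    then have "free_points G ?X ?\<phi> \<noteq> {}" using free by blast
    then show ?thesis using X.minimal_imp_topologically_free mp[OF min that] by blast
  qed
  moreover have "\<exists>\<nu>. lift_of G ?X ?\<phi> fst \<mu> \<nu> \<and> essentially_free G ?\<phi> \<nu>"
    if \<mu>: "ergodic_measure G Y \<psi> \<mu>" "measure \<mu> ?Y\<^sub>H = 1" for \<mu>
  proof -
    have inv: "invariant_measure G Y \<psi> \<mu>" using \<mu>(1) by (simp add: ergodic_measure_def)
    obtain \<nu> where \<nu>: "lift_of G ?X ?\<phi> fst \<mu> \<nu>"
      using exists_lift[OF C bspec[OF k(2)] k(1) inv] ..
    have \<nu>_sets: "sets \<nu> = sets (borel_algebra ?X)" and \<nu>_space: "space \<nu> = C"
      and distr: "distr \<nu> \<mu> fst = \<mu>" and \<mu>_sets: "sets \<mu> = sets (borel_algebra Y)"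
      using \<nu> inv topX by (auto simp: lift_of_def invariant_measure_def)
    have "fst \<in> measurable (borel_algebra ?X) (borel_algebra Y)"
      by (intro continuous_map_imp_borel_measurable continuous_map_from_subtopology continuous_map_fst_skew)
    then have fst: "fst \<in> measurable \<nu> \<mu>"
      by (simp cong: measurable_cong_sets add: \<nu>_sets \<mu>_sets)
    have "AE y in \<mu>. y \<in> ?Y\<^sub>H"
      using inv \<mu>(2) prob_space.AE_prob_1 by (auto simp: invariant_measure_def)
    then have "AE y in distr \<nu> \<mu> fst. y \<in> ?Y\<^sub>H" unfolding distr .
    then have "AE p in \<nu>. fst p \<in> ?Y\<^sub>H" by (rule AE_distrD[OF fst])
    moreover have "AE p in \<nu>. fst p \<in> ?Y\<^sub>H \<longrightarrow> stabilizer G ?\<phi> p = {\<one>\<^bsub>G\<^esub>}"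
    proof (rule AE_I2, rule impI)
      fix p assume "p \<in> space \<nu>" "fst p \<in> ?Y\<^sub>H"
      then show "stabilizer G ?\<phi> p = {\<one>\<^bsub>G\<^esub>}" unfolding \<nu>_space by (rule stab)
    qed
    ultimately have "AE p in \<nu>. stabilizer G ?\<phi> p = {\<one>\<^bsub>G\<^esub>}" by (rule AE_mp)
    then show ?thesis using \<nu> unfolding essentially_free_def by blast
  qed
  moreover have "dynamical_system G ?X ?\<phi>" by (rule X.dynamical_system_axioms)
  moreover have "factor_map G ?X ?\<phi> Y \<psi> fst" by (rule factor_map_fst[OF C(1) surj])
  moreover have "k \<ge> 1" using k(1) by simp
  ultimately show ?thesis
    using free fib min by (intro exI[of _ ?X] exI[of _ ?\<phi>] exI[of _ fst] exI[of _ k] conjI) blast+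
qed

end
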